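(* Let $(GS,\varphi)$ be a Separated GR($k$) game over $\mathcal I\cup\mathcal O$, and let $B=(GS,\mathsf G\mathsf F(\mathrm{acc}))$ be the associated Büchi game, where $\mathrm{acc}$ holds exactly at the states that belong to accepting SCCs. Let $i_0,\dots,i_n\in(2^{\mathcal I})^+$ be a path in $G_{\mathcal I}$ and, for $m\ge 0$, let $o_{-m},\dots,o_0\in(2^{\mathcal O})^+$ be a path in $G_{\mathcal O}$. Assume that the system can win $B$ from $(i_0,o_0)$. Then the system can also win $B$ from $(i_n,o_{-m})$.
   Context: States and assertions. A state over a finite set $\mathcal V$ of Boolean variables is a subset of $\mathcal V$ (the variables assigned true). $\mathcal V'$ is a disjoint primed copy of $\mathcal V$, and $s'$ the primed copy of a state $s$. An assertion over $\mathcal V$ is a Boolean formula over $\mathcal V$. Separated game structure: $GS=(\mathcal I,\mathcal O,\theta_{\mathcal I},\theta_{\mathcal O},\rho_{\mathcal I},\rho_{\mathcal O})$, where $\mathcal I,\mathcal O$ are disjoint finite sets of Boolean variables (controlled by the environment and the system, respectively), $\theta_{\mathcal I}$ is an assertion over $\mathcal I$, $\theta_{\mathcal O}$ over $\mathcal O$, $\rho_{\mathcal I}$ over $\mathcal I\cup\mathcal I'$, $\rho_{\mathcal O}$ over $\mathcal O\cup\mathcal O'$. Both are deadlock free: every $i_0$ has some $i_1$ with $(i_0,i_1')\models\rho_{\mathcal I}$ and every $o_0$ has some $o_1$ with $(o_0,o_1')\models\rho_{\mathcal O}$. Graphs. $G_{\mathcal I}$ is the directed graph on $2^{\mathcal I}$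 with an edge $s\to t$ iff $(s,t')\models\rho_{\mathcal I}$; $G_{\mathcal O}$ is the directed graph on $2^{\mathcal O}$ with an edge $s\to t$ iff $(s,t')\models\rho_{\mathcal O}$. The game graph $G$ has vertex set $2^{\mathcal I\cup\mathcal O}$ and an edge $s\to t$ iff $(s,t')\models\rho_{\mathcal I}\wedge\rho_{\mathcal O}$. An SCC is a maximal set of vertices in which every vertex is reachable from every other (single vertices count); the SCCs partition the vertices. Separated GR($k$) winning condition: $\varphi=\bigwedge_{l=1}^k\big(\bigwedge_{i=1}^{n_l}\mathsf G\mathsf F(a_{l,i})\rightarrow\bigwedge_{j=1}^{m_l}\mathsf G\mathsf F(g_{l,j})\big)$, with each $a_{l,i}$ an assertion over $\mathcal I$ and each $g_{l,j}$ an assertion over $\mathcal O$; $\mathsf G\mathsf F(p)$ means that $p$ holds at infinitely many positions. A Separated GR($k$) game is a pair $(GS,\varphi)$ of this kind. Accepting SCCs. For an SCC $S$ of $G$ let $S_{\mathcal I}=\{s\cap\mathcal I\mid s\in S\}$ and $S_{\mathcal O}=\{s\cap\mathcal O\mid s\in S\}$. $S$ is accepting if for every $l\in\{1,\dots,k\}$ either (i) for every $j\in\{1,\dots,m_l\}$ there is $o\in S_{\mathcal O}$ with $o\models g_{l,j}$, or (ii) there is $j\in\{1,\dots,n_l\}$ such that $i\not\models a_{l,j}$ for all $i\in S_{\mathcal I}$. Plays and strategies. A play from $s_0$ is an infinite path $s_0,s_1,\dots$ in $G$. A strategy (for the system) is a function $f:(2^{\mathcal I\cup\mathcal O})^+\times2^{\mathcal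 I}\to2^{\mathcal O}$ returning legal moves: for a finite play prefix $s_0,\dots,s_m$ and $i$ with $(s_m,i')\models\rho_{\mathcal I}$, $o=f(s_0,\dots,s_m,i)$ satisfies $(s_m,i',o')\models\rho_{\mathcal O}$. A play with $s_j=(i_j,o_j)$ is consistent with $f$ if $o_{j+1}=f(s_0,\dots,s_j,i_{j+1})$ for all $j\ge0$. The system can win a game with winning condition $\psi$ from $s$ if there is a strategy $f$ such that every play from $s$ consistent with $f$ satisfies $\psi$. *)

theory Defs
  imports Main
begin

datatype 'v form =
    FTrue
  | FVar 'v
  | FNot "'v form"
  | FAnd "'v form" "'v form"
  | FOr "'v form" "'v form"

(* A state is the set of variables assigned true. *)
primrec sat :: "'v set \<Rightarrow> 'v form \<Rightarrow> bool" where
  "sat s FTrue \<longleftrightarrow> True"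
| "sat s (FVar x) \<longleftrightarrow> x \<in> s"
| "sat s (FNot p) \<longleftrightarrow> \<not> sat s p"
| "sat s (FAnd p q) \<longleftrightarrow> sat s p \<and> sat s q"
| "sat s (FOr p q) \<longleftrightarrow> sat s p \<or> sat s q"

definition assertion_over :: "'v set \<Rightarrow> 'v form \<Rightarrow> bool" where
  "assertion_over V p \<longleftrightarrow> set_form p \<subseteq> V"

(* Nxt x is the primed copy of x. *)
datatype 'v pvar = Cur 'v | Nxt 'v

(* (s, t') satisfies p *)
definition sat_step :: "'v set \<Rightarrow> 'v set \<Rightarrow> 'v pvar form \<Rightarrow> bool" where
  "sat_step s t p \<longleftrightarrow> sat (Cur ` s \<union> Nxt ` t) p"

record 'v game_structure =
  env_vars :: "'v set"
  sys_vars :: "'v set"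
  env_init :: "'v form"
  sys_init :: "'v form"
  env_trans :: "'v pvar form"
  sys_trans :: "'v pvar form"

definition deadlock_free :: "'v set \<Rightarrow> 'v pvar form \<Rightarrow> bool" where
  "deadlock_free V p \<longleftrightarrow> (\<forall>s\<subseteq>V. \<exists>t\<subseteq>V. sat_step s t p)"

definition separated_game_structure :: "'v game_structure \<Rightarrow> bool" where
  "separated_game_structure GS \<longleftrightarrow>
     finite (env_vars GS) \<and> finite (sys_vars GS) \<and> env_vars GS \<inter> sys_vars GS = {} \<and>
     assertion_over (env_vars GS) (env_init GS) \<and>
     assertion_over (sys_vars GS) (sys_init GS) \<and>
     assertion_over (Cur ` env_vars GS \<union> Nxt ` env_vars GS) (env_trans GS) \<and>
     assertion_over (Cur ` sys_vars GS \<union> Nxt ` sys_vars GS) (sys_trans GS) \<and>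
     deadlock_free (env_vars GS) (env_trans GS) \<and>
     deadlock_free (sys_vars GS) (sys_trans GS)"

definition states :: "'v game_structure \<Rightarrow> 'v set set" where
  "states GS = Pow (env_vars GS \<union> sys_vars GS)"

definition env_graph :: "'v game_structure \<Rightarrow> 'v set rel" where
  "env_graph GS = {(s, t). s \<subseteq> env_vars GS \<and> t \<subseteq> env_vars GS \<and> sat_step s t (env_trans GS)}"

definition sys_graph :: "'v game_structure \<Rightarrow> 'v set rel" where
  "sys_graph GS = {(s, t). s \<subseteq> sys_vars GS \<and> t \<subseteq> sys_vars GS \<and> sat_step s t (sys_trans GS)}"

definition game_graph :: "'v game_structure \<Rightarrow> 'v set rel" where
  "game_graph GS = {(s, t). s \<in> states GS \<and> t \<in> states GS \<and>
     sat_step s t (env_trans GS) \<and> sat_step s t (sys_trans GS)}"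

definition finite_path :: "'a set \<Rightarrow> 'a rel \<Rightarrow> 'a list \<Rightarrow> bool" where
  "finite_path V E xs \<longleftrightarrow> xs \<noteq> [] \<and> set xs \<subseteq> V \<and> successively (\<lambda>s t. (s, t) \<in> E) xs"

definition mutually_reachable :: "'a rel \<Rightarrow> 'a set \<Rightarrow> bool" where
  "mutually_reachable E S \<longleftrightarrow> (\<forall>u\<in>S. \<forall>v\<in>S. (u, v) \<in> E\<^sup>*)"

definition is_SCC :: "'a set \<Rightarrow> 'a rel \<Rightarrow> 'a set \<Rightarrow> bool" where
  "is_SCC V E S \<longleftrightarrow> S \<noteq> {} \<and> S \<subseteq> V \<and> mutually_reachable E S \<and>
     (\<forall>T. S \<subseteq> T \<and> T \<subseteq> V \<and> mutually_reachable E T \<longrightarrow> T = S)"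

(* The l-th entry is the pair of lists ([a_{l,1}, ..., a_{l,n_l}], [g_{l,1}, ..., g_{l,m_l}]). *)
type_synonym 'v gr_spec = "('v form list \<times> 'v form list) list"

definition separated_GR_game :: "nat \<Rightarrow> 'v game_structure \<Rightarrow> 'v gr_spec \<Rightarrow> bool" where
  "separated_GR_game k GS \<phi> \<longleftrightarrow> separated_game_structure GS \<and> length \<phi> = k \<and>
     (\<forall>(as, gs)\<in>set \<phi>. (\<forall>a\<in>set as. assertion_over (env_vars GS) a) \<and>
                       (\<forall>g\<in>set gs. assertion_over (sys_vars GS) g))"

(* A winning condition is a predicate on infinite sequences of states. *)
definition GF :: "('v set \<Rightarrow> bool) \<Rightarrow> (nat \<Rightarrow> 'v set) \<Rightarrow> bool" where
  "GF p \<sigma> \<longleftrightarrow> infinite {n. p (\<sigma> n)}"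

(* The winning condition denoted by a GR(k) specification. The associated Buechi game depends
   on the specification only through the accepting SCCs below. *)
definition GR_condition :: "'v gr_spec \<Rightarrow> (nat \<Rightarrow> 'v set) \<Rightarrow> bool" where
  "GR_condition \<phi> \<sigma> \<longleftrightarrow> (\<forall>(as, gs)\<in>set \<phi>.
     (\<forall>a\<in>set as. GF (\<lambda>s. sat s a) \<sigma>) \<longrightarrow> (\<forall>g\<in>set gs. GF (\<lambda>s. sat s g) \<sigma>))"

definition accepting :: "'v game_structure \<Rightarrow> 'v gr_spec \<Rightarrow> 'v set set \<Rightarrow> bool" where
  "accepting GS \<phi> S \<longleftrightarrow> (\<forall>(as, gs)\<in>set \<phi>.
     (\<forall>g\<in>set gs. \<exists>q\<in>(\<lambda>s. s \<inter> sys_vars GS) ` S. sat q g) \<or>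
     (\<exists>a\<in>set as. \<forall>i\<in>(\<lambda>s. s \<inter> env_vars GS) ` S. \<not> sat i a))"

definition acc :: "'v game_structure \<Rightarrow> 'v gr_spec \<Rightarrow> 'v set \<Rightarrow> bool" where
  "acc GS \<phi> s \<longleftrightarrow> (\<exists>S. is_SCC (states GS) (game_graph GS) S \<and> accepting GS \<phi> S \<and> s \<in> S)"

definition play_from :: "'v game_structure \<Rightarrow> 'v set \<Rightarrow> (nat \<Rightarrow> 'v set) \<Rightarrow> bool" where
  "play_from GS s \<sigma> \<longleftrightarrow> \<sigma> 0 = s \<and> (\<forall>n. (\<sigma> n, \<sigma> (Suc n)) \<in> game_graph GS)"

type_synonym 'v strat = "'v set list \<Rightarrow> 'v set \<Rightarrow> 'v set"

(* The first conjunct is the typing of f as a map into 2^O on nonempty state sequences and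
   inputs; the second requires legal moves. *)
definition strategy :: "'v game_structure \<Rightarrow> 'v strat \<Rightarrow> bool" where
  "strategy GS f \<longleftrightarrow>
     (\<forall>h i. h \<noteq> [] \<and> set h \<subseteq> states GS \<and> i \<subseteq> env_vars GS \<longrightarrow> f h i \<subseteq> sys_vars GS) \<and>
     (\<forall>h i. finite_path (states GS) (game_graph GS) h \<and> i \<subseteq> env_vars GS \<and>
            sat_step (last h) i (env_trans GS) \<longrightarrow>
            sat_step (last h) (i \<union> f h i) (sys_trans GS))"

definition consistent :: "'v game_structure \<Rightarrow> 'v strat \<Rightarrow> (nat \<Rightarrow> 'v set) \<Rightarrow> bool" where
  "consistent GS f \<sigma> \<longleftrightarrow> (\<forall>j. \<sigma> (Suc j) \<inter> sys_vars GS =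
     f (map \<sigma> [0..<Suc j]) (\<sigma> (Suc j) \<inter> env_vars GS))"

definition sys_can_win ::
  "'v game_structure \<Rightarrow> ((nat \<Rightarrow> 'v set) \<Rightarrow> bool) \<Rightarrow> 'v set \<Rightarrow> bool" where
  "sys_can_win GS \<psi> s \<longleftrightarrow>
     (\<exists>f. strategy GS f \<and> (\<forall>\<sigma>. play_from GS s \<sigma> \<and> consistent GS f \<sigma> \<longrightarrow> \<psi> \<sigma>))"

end

theory Submission
  imports Defs "HOL-Library.Infinite_Set"
begin

text \<open>
  The system follows \<open>o\<^sub>-\<^sub>m, \<dots>, o\<^sub>0\<close> for the first \<open>m\<close> steps while it records the moves of the
  environment, and from then on it answers as the given strategy does in a simulated play from
  \<open>(i\<^sub>0, o\<^sub>0)\<close> in which the environment plays \<open>i\<^sub>0, \<dots>, i\<^sub>n\<close> and then the recorded moves.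
  The real play is thus the simulated one with the input component shifted by \<open>n + m\<close> against the
  output component. Both plays end up in the same SCC of \<open>G\<^sub>I\<close> and in the same SCC of \<open>G\<^sub>O\<close>,
  though possibly in different SCCs of \<open>G\<close>. This is harmless: an SCC of \<open>G\<close> that contains a cycle
  projects onto full SCCs of \<open>G\<^sub>I\<close> and \<open>G\<^sub>O\<close>, so whether it is accepting depends on these only.
\<close>

section \<open>Strongly connected components and infinite paths\<close>

definition scc_of :: "'a rel \<Rightarrow> 'a \<Rightarrow> 'a set" where
  "scc_of E x = {y. (x, y) \<in> E\<^sup>* \<and> (y, x) \<in> E\<^sup>*}"

lemma scc_of_refl [simp]: "x \<in> scc_of E x"
  by (simp add: scc_of_def)

lemma scc_of_eq:
  assumes "y \<in> scc_of E x"
  shows "scc_of E y = scc_of E x"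
  using assms unfolding scc_of_def by (auto intro: rtrancl_trans)

lemma is_SCC_scc_of:
  assumes "E \<subseteq> V \<times> V" and "s \<in> V"
  shows "is_SCC V E (scc_of E s)"
proof -
  have "scc_of E s \<subseteq> V"
    using assms by (auto simp: scc_of_def elim: rtranclE)
  moreover have "mutually_reachable E (scc_of E s)"
    unfolding mutually_reachable_def scc_of_def by (auto intro: rtrancl_trans)
  moreover have "T = scc_of E s" if "scc_of E s \<subseteq> T" "mutually_reachable E T" for T
  proof
    have "s \<in> T" using that(1) scc_of_refl by (rule subsetD)
    then show "T \<subseteq> scc_of E s"
      using that(2) unfolding mutually_reachable_def scc_of_def by blast
  qed (fact that(1))
  ultimately show ?thesis
    unfolding is_SCC_def using scc_of_refl[of s E] by blast
qed

text \<open>A mutually reachable set lies in the class of each of its elements, so maximality leaves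
  only the class itself.\<close>

lemma is_SCC_eq_scc_of:
  assumes "E \<subseteq> V \<times> V" and "is_SCC V E S" and "s \<in> S"
  shows "S = scc_of E s"
proof -
  have "S \<subseteq> scc_of E s"
    using assms(2,3) unfolding is_SCC_def mutually_reachable_def scc_of_def by blast
  moreover have "is_SCC V E (scc_of E s)"
    using assms by (intro is_SCC_scc_of) (auto simp: is_SCC_def)
  ultimately show ?thesis
    using assms(2) unfolding is_SCC_def by blast
qed

lemma relpow_closed_mult: "(x, x) \<in> R ^^ m \<Longrightarrow> (x, x) \<in> R ^^ (m * n)"
proof (induction n)
  case (Suc n)
  then show ?case using relpow_trans[of x x m R x "m * n"] by simp
qed simp

text \<open>A cycle of length \<open>p\<close> in \<open>A\<close> through both \<open>c\<close> and \<open>c'\<close> and a cycle of length \<open>q\<close> in \<open>B\<close>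
  run in lockstep as cycles of length \<open>p * q\<close>.\<close>

lemma lockstep_cycles:
  assumes "c' \<in> scc_of A c" and "(d, d) \<in> B\<^sup>+"
  obtains k l d' where "(c, c') \<in> A ^^ k" "(c', c) \<in> A ^^ l" "(d, d') \<in> B ^^ k" "(d', d) \<in> B ^^ l"
proof -
  obtain a b where a: "(c, c') \<in> A ^^ a" and b: "(c', c) \<in> A ^^ b"
    using assms(1) unfolding scc_of_def by (auto simp: rtrancl_is_UN_relpow)
  obtain q where q: "(d, d) \<in> B ^^ Suc q"
    using assms(2) by (metis trancl_power gr0_implies_Suc)
  \<comment> \<open>From \<open>c'\<close> the \<open>A\<close> walk returns by \<open>b\<close>
    steps and goes round \<open>q\<close> more times, so that the total is a multiple of
    \<open>Suc q\<close>, the cycle length at \<open>d\<close>. The witness \<open>d'\<close> is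
    where the \<open>B\<close> walk stands after \<open>a\<close> steps.\<close>
  define l where "l = b + (a + b) * q"
  have "(c', c) \<in> A ^^ l"
    unfolding l_def using b relpow_closed_mult[OF relpow_trans[OF a b]] by (rule relpow_trans)
  moreover have "a + l = Suc q * (a + b)"
    by (simp add: l_def algebra_simps)
  then have "(d, d) \<in> B ^^ (a + l)"
    using relpow_closed_mult[OF q] by metis
  then obtain d' where "(d, d') \<in> B ^^ a" "(d', d) \<in> B ^^ l"
    by (auto simp: relpow_add)
  ultimately show thesis using a that by blast
qed

section \<open>Recurrence along infinite paths\<close>

lemma infinite_path_rtrancl:
  assumes "\<And>n. (x n, x (Suc n)) \<in> E" and "a \<le> b"
  shows "(x a, x b) \<in> E\<^sup>*"
  using assms(2) by (induction rule: dec_induct) (auto intro: rtrancl_into_rtrancl assms(1))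

text \<open>The second visit is taken at \<open>Suc a\<close> or later, so the walk between the two
  visits is nonempty.\<close>

lemma recurrent_cycle:
  assumes "\<And>n. (x n, x (Suc n)) \<in> E" and "infinite {n. x n = s}"
  shows "(s, s) \<in> E\<^sup>+"
proof -
  obtain a where a: "x a = s"
    using infinite_imp_nonempty[OF assms(2)] by auto
  obtain b where b: "Suc a \<le> b" "x b = s"
    using assms(2) unfolding infinite_nat_iff_unbounded_le by auto
  have "(x (Suc a), x b) \<in> E\<^sup>*"
    using assms(1) b(1) by (rule infinite_path_rtrancl)
  then show ?thesis
    using assms(1)[of a] a b(2) by (auto intro: rtrancl_into_trancl2)
qed

text \<open>After one visit to \<open>s\<close> every state is reachable from \<open>s\<close>, and
  a later visit always leads back.\<close>

lemma recurrent_scc: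
  assumes "\<And>n. (x n, x (Suc n)) \<in> E" and "infinite {n. x n = s}"
  obtains N where "\<And>n. N \<le> n \<Longrightarrow> x n \<in> scc_of E s"
proof -
  obtain N where N: "x N = s"
    using infinite_imp_nonempty[OF assms(2)] by auto
  have "x n \<in> scc_of E s" if "N \<le> n" for n
  proof -
    obtain b where "n \<le> b" "x b = s"
      using assms(2) unfolding infinite_nat_iff_unbounded_le by auto
    then show ?thesis
      using infinite_path_rtrancl[of x E N n, OF assms(1)] infinite_path_rtrancl[of x E n b, OF assms(1)]
        that N unfolding scc_of_def by simp
  qed
  then show thesis by (rule that)
qed

lemma recurrent_value:
  fixes x :: "nat \<Rightarrow> 'a"
  assumes "finite V" and "\<And>n. x n \<in> V" and "infinite {n. P (x n)}"
  obtains s where "P s" "infinite {n. x n = s}"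
proof -
  have "finite (x ` {n. P (x n)})"
    using assms(1,2) by (auto intro: finite_subset)
  then obtain n where "P (x n)" "infinite {m \<in> {n. P (x n)}. x m = x n}"
    using pigeonhole_infinite[OF assms(3)] by blast
  then show thesis
    using that[of "x n"] by (metis (mono_tags, lifting) Collect_mono infinite_super mem_Collect_eq)
qed

section \<open>Separation of the game graph\<close>

lemma sat_restrict: "set_form p \<subseteq> V \<Longrightarrow> sat s p \<longleftrightarrow> sat (s \<inter> V) p"
  by (induction p) auto

lemma sat_step_restrict:
  assumes "assertion_over (Cur ` V \<union> Nxt ` V) p"
  shows "sat_step s t p \<longleftrightarrow> sat_step (s \<inter> V) (t \<inter> V) p"
proof -
  have "(Cur ` s \<union> Nxt ` t) \<inter> (Cur ` V \<union> Nxt ` V) =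
      (Cur ` (s \<inter> V) \<union> Nxt ` (t \<inter> V)) \<inter> (Cur ` V \<union> Nxt ` V)"
    by auto
  then show ?thesis
    using assms sat_restrict unfolding sat_step_def assertion_over_def by metis
qed

text \<open>Each transition assertion sees only its own variables, so \<open>game_graph\<close> is
  the synchronous product of the two component graphs.\<close>

lemma game_graph_iff:
  assumes "separated_game_structure GS"
  shows "(s, t) \<in> game_graph GS \<longleftrightarrow> s \<in> states GS \<and> t \<in> states GS \<and>
    (s \<inter> env_vars GS, t \<inter> env_vars GS) \<in> env_graph GS \<and>
    (s \<inter> sys_vars GS, t \<inter> sys_vars GS) \<in> sys_graph GS"
  using assms sat_step_restrict[of "env_vars GS" "env_trans GS" s t]
    sat_step_restrict[of "sys_vars GS" "sys_trans GS" s t]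
  unfolding separated_game_structure_def game_graph_def env_graph_def sys_graph_def by auto

text \<open>Walks in a synchronous product combine only at equal lengths, hence
  \<open>relpow\<close> with a common exponent instead of plain reachability.\<close>

lemma game_graph_relpow:
  assumes "separated_game_structure GS"
    and "s \<in> states GS" "t \<in> states GS"
    and "(s \<inter> env_vars GS, t \<inter> env_vars GS) \<in> env_graph GS ^^ k"
    and "(s \<inter> sys_vars GS, t \<inter> sys_vars GS) \<in> sys_graph GS ^^ k"
  shows "(s, t) \<in> game_graph GS ^^ k"
  using assms(3-)
proof (induction k arbitrary: t)
  case 0
  then show ?case using assms(2) unfolding states_def by auto
next
  case (Suc k)
  obtain u v where u: "(s \<inter> env_vars GS, u) \<in> env_graph GS ^^ k" "(u, t \<inter> env_vars GS) \<in> env_graph GS"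
    and v: "(s \<inter> sys_vars GS, v) \<in> sys_graph GS ^^ k" "(v, t \<inter> sys_vars GS) \<in> sys_graph GS"
    using Suc.prems by auto
  have "u \<subseteq> env_vars GS" "v \<subseteq> sys_vars GS"
    using u v unfolding env_graph_def sys_graph_def by auto
  then have *: "(u \<union> v) \<inter> env_vars GS = u" "(u \<union> v) \<inter> sys_vars GS = v" "u \<union> v \<in> states GS"
    using assms(1) unfolding separated_game_structure_def states_def by auto
  then have "(s, u \<union> v) \<in> game_graph GS ^^ k"
    using Suc.IH[of "u \<union> v"] u v by simp
  moreover have "(u \<union> v, t) \<in> game_graph GS"
    unfolding game_graph_iff[OF assms(1)] using * u v Suc.prems by simp
  ultimately show ?case by auto
qed

lemma rtrancl_image:
  assumes "\<And>s t. (s, t) \<in> E \<Longrightarrow> (p s, p t) \<in> F" and "(s, t) \<in> E\<^sup>*"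
  shows "(p s, p t) \<in> F\<^sup>*"
  using assms(2) by induction (auto intro: rtrancl_into_rtrancl assms(1))

lemma trancl_image:
  assumes "\<And>s t. (s, t) \<in> E \<Longrightarrow> (p s, p t) \<in> F" and "(s, t) \<in> E\<^sup>+"
  shows "(p s, p t) \<in> F\<^sup>+"
  using assms(2) by induction (auto intro: trancl_into_trancl assms(1))

text \<open>Walks project to walks, which gives one inclusion. For the other, one component travels
  to the target and back while the other goes round its cycle in lockstep. The cycle through
  \<open>s\<close> matters: otherwise \<open>s\<close> is alone in its SCC, though one of its
  components may lie in a larger one.\<close>

lemma scc_projections:
  assumes sep: "separated_game_structure GS"
    and cyc: "(s, s) \<in> (game_graph GS)\<^sup>+"
  shows "(\<lambda>s. s \<inter> env_vars GS) ` scc_of (game_graph GS) s = scc_of (env_graph GS) (s \<inter> env_vars GS)"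
    and "(\<lambda>s. s \<inter> sys_vars GS) ` scc_of (game_graph GS) s = scc_of (sys_graph GS) (s \<inter> sys_vars GS)"
proof -
  note edge = game_graph_iff[OF sep]
  have s: "s \<in> states GS"
    using cyc by (auto elim: tranclE simp: edge)
  have sub: "t \<inter> env_vars GS \<in> scc_of (env_graph GS) (s \<inter> env_vars GS)"
    "t \<inter> sys_vars GS \<in> scc_of (sys_graph GS) (s \<inter> sys_vars GS)"
    if "t \<in> scc_of (game_graph GS) s" for t
    using that rtrancl_image[of "game_graph GS" "\<lambda>s. s \<inter> env_vars GS" "env_graph GS"]
      rtrancl_image[of "game_graph GS" "\<lambda>s. s \<inter> sys_vars GS" "sys_graph GS"]
    unfolding scc_of_def edge by blast+
  have lift: "c \<union> d \<in> scc_of (game_graph GS) s \<and> (c \<union> d) \<inter> env_vars GS = c \<and> (c \<union> d) \<inter> sys_vars GS = d"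
    if "c \<subseteq> env_vars GS" "d \<subseteq> sys_vars GS"
      "(s \<inter> env_vars GS, c) \<in> env_graph GS ^^ k" "(c, s \<inter> env_vars GS) \<in> env_graph GS ^^ l"
      "(s \<inter> sys_vars GS, d) \<in> sys_graph GS ^^ k" "(d, s \<inter> sys_vars GS) \<in> sys_graph GS ^^ l"
    for c d k l
  proof -
    have *: "(c \<union> d) \<inter> env_vars GS = c" "(c \<union> d) \<inter> sys_vars GS = d" "c \<union> d \<in> states GS"
      using that(1,2) sep unfolding separated_game_structure_def states_def by auto
    have "(s, c \<union> d) \<in> game_graph GS ^^ k" "(c \<union> d, s) \<in> game_graph GS ^^ l"
      using that * s by (auto intro!: game_graph_relpow[OF sep])
    then show ?thesis
      using * unfolding scc_of_def by (auto intro: relpow_imp_rtrancl)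
  qed
  have field: "c \<subseteq> env_vars GS" if "(s \<inter> env_vars GS, c) \<in> env_graph GS ^^ k" for c k
    using that by (cases k) (auto simp: env_graph_def)
  have field': "d \<subseteq> sys_vars GS" if "(s \<inter> sys_vars GS, d) \<in> sys_graph GS ^^ k" for d k
    using that by (cases k) (auto simp: sys_graph_def)
  have cycE: "(s \<inter> env_vars GS, s \<inter> env_vars GS) \<in> (env_graph GS)\<^sup>+"
    and cycS: "(s \<inter> sys_vars GS, s \<inter> sys_vars GS) \<in> (sys_graph GS)\<^sup>+"
    using cyc trancl_image[of "game_graph GS" "\<lambda>s. s \<inter> env_vars GS" "env_graph GS"]
      trancl_image[of "game_graph GS" "\<lambda>s. s \<inter> sys_vars GS" "sys_graph GS"]
    unfolding edge by blast+
  show "(\<lambda>s. s \<inter> env_vars GS) ` scc_of (game_graph GS) s = scc_of (env_graph GS) (s \<inter> env_vars GS)"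
  proof (intro equalityI subsetI)
    fix c assume "c \<in> scc_of (env_graph GS) (s \<inter> env_vars GS)"
    then obtain k l d where w: "(s \<inter> env_vars GS, c) \<in> env_graph GS ^^ k"
      "(c, s \<inter> env_vars GS) \<in> env_graph GS ^^ l"
      "(s \<inter> sys_vars GS, d) \<in> sys_graph GS ^^ k" "(d, s \<inter> sys_vars GS) \<in> sys_graph GS ^^ l"
      using cycS by (rule lockstep_cycles)
    show "c \<in> (\<lambda>s. s \<inter> env_vars GS) ` scc_of (game_graph GS) s"
      using lift[OF field[OF w(1)] field'[OF w(3)] w] by (metis image_eqI)
  qed (use sub in auto)
  show "(\<lambda>s. s \<inter> sys_vars GS) ` scc_of (game_graph GS) s = scc_of (sys_graph GS) (s \<inter> sys_vars GS)"
  proof (intro equalityI subsetI)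
    fix d assume "d \<in> scc_of (sys_graph GS) (s \<inter> sys_vars GS)"
    then obtain k l c where w: "(s \<inter> sys_vars GS, d) \<in> sys_graph GS ^^ k"
      "(d, s \<inter> sys_vars GS) \<in> sys_graph GS ^^ l"
      "(s \<inter> env_vars GS, c) \<in> env_graph GS ^^ k" "(c, s \<inter> env_vars GS) \<in> env_graph GS ^^ l"
      using cycE by (rule lockstep_cycles)
    show "d \<in> (\<lambda>s. s \<inter> sys_vars GS) ` scc_of (game_graph GS) s"
      using lift[OF field[OF w(3)] field'[OF w(1)] w(3,4,1,2)] by (metis image_eqI)
  qed (use sub in auto)
qed

section \<open>Acceptance in terms of component SCCs\<close>

lemma acc_iff_accepting_scc_of:
  assumes "s \<in> states GS"
  shows "acc GS \<phi> s \<longleftrightarrow> accepting GS \<phi> (scc_of (game_graph GS) s)"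
proof -
  have "game_graph GS \<subseteq> states GS \<times> states GS"
    unfolding game_graph_def by auto
  then show ?thesis
    unfolding acc_def using assms is_SCC_scc_of is_SCC_eq_scc_of scc_of_refl by metis
qed

text \<open>\<open>accepting\<close> inspects an SCC only through its two projections. On cycles
  these are the component SCCs, which \<open>s\<close> and \<open>t\<close> share even if their SCCs
  in the game graph differ.\<close>

lemma acc_cong:
  assumes "separated_game_structure GS"
    and "(s, s) \<in> (game_graph GS)\<^sup>+" and "(t, t) \<in> (game_graph GS)\<^sup>+"
    and "t \<inter> env_vars GS \<in> scc_of (env_graph GS) (s \<inter> env_vars GS)"
    and "t \<inter> sys_vars GS \<in> scc_of (sys_graph GS) (s \<inter> sys_vars GS)"
  shows "acc GS \<phi> t \<longleftrightarrow> acc GS \<phi> s"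
proof -
  have st: "s \<in> states GS" "t \<in> states GS"
    using assms(2,3) by (auto elim: tranclE simp: game_graph_def)
  show ?thesis
    unfolding acc_iff_accepting_scc_of[OF st(1)] acc_iff_accepting_scc_of[OF st(2)] accepting_def
      scc_projections[OF assms(1,2)] scc_projections[OF assms(1,3)]
      scc_of_eq[OF assms(4)] scc_of_eq[OF assms(5)] ..
qed

text \<open>A recurring accepting state \<open>s\<close> fixes the component SCCs in which the
  projections of \<open>\<sigma>\<close> finally stay. Shifts preserve this, so any recurring state
  \<open>t\<close> of \<open>\<tau>\<close> has its components there; both states lie on cycles, and
  \<open>acc_cong\<close> applies.\<close>

lemma GF_acc_shift:
  assumes sep: "separated_game_structure GS"
    and \<sigma>: "\<And>n. (\<sigma> n, \<sigma> (Suc n)) \<in> game_graph GS"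
    and \<tau>: "\<And>n. (\<tau> n, \<tau> (Suc n)) \<in> game_graph GS"
    and env: "\<And>n. \<tau> (n + m) \<inter> env_vars GS = \<sigma> (n + d) \<inter> env_vars GS"
    and sys: "\<And>n. \<tau> (n + m) \<inter> sys_vars GS = \<sigma> n \<inter> sys_vars GS"
    and GF: "GF (acc GS \<phi>) \<sigma>"
  shows "GF (acc GS \<phi>) \<tau>"
proof -
  have fin: "finite (states GS)"
    using sep unfolding separated_game_structure_def states_def by simp
  have in_states: "\<sigma> n \<in> states GS" "\<tau> n \<in> states GS" for n
    using \<sigma>[of n] \<tau>[of n] by (auto simp: game_graph_def)
  obtain s where s: "acc GS \<phi> s" "infinite {n. \<sigma> n = s}"
    using fin in_states(1) GF[unfolded GF_def] by (rule recurrent_value)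
  obtain t where t: "infinite {n. \<tau> n = t}"
    by (rule recurrent_value[OF fin, of \<tau> "\<lambda>_. True"]) (auto intro: in_states)
  have "infinite {n. \<sigma> n \<inter> X = s \<inter> X}" for X
    using s(2) by (rule infinite_super[rotated]) auto
  then obtain M N where M: "\<And>n. M \<le> n \<Longrightarrow> \<sigma> n \<inter> env_vars GS \<in> scc_of (env_graph GS) (s \<inter> env_vars GS)"
    and N: "\<And>n. N \<le> n \<Longrightarrow> \<sigma> n \<inter> sys_vars GS \<in> scc_of (sys_graph GS) (s \<inter> sys_vars GS)"
    using recurrent_scc[of "\<lambda>n. \<sigma> n \<inter> env_vars GS" "env_graph GS" "s \<inter> env_vars GS"]
      recurrent_scc[of "\<lambda>n. \<sigma> n \<inter> sys_vars GS" "sys_graph GS" "s \<inter> sys_vars GS"]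
      \<sigma> game_graph_iff[OF sep] by metis
  obtain b where "M + N + m \<le> b" "\<tau> b = t"
    using t unfolding infinite_nat_iff_unbounded_le by auto
  then have "t \<inter> env_vars GS \<in> scc_of (env_graph GS) (s \<inter> env_vars GS)"
    "t \<inter> sys_vars GS \<in> scc_of (sys_graph GS) (s \<inter> sys_vars GS)"
    using env[of "b - m"] sys[of "b - m"] M[of "b - m + d"] N[of "b - m"] by auto
  then have "acc GS \<phi> t"
    using acc_cong[OF sep recurrent_cycle[OF \<sigma> s(2)] recurrent_cycle[OF \<tau> t]] s(1) by blast
  then show ?thesis
    unfolding GF_def using t by (auto elim!: infinite_super[rotated])
qed

section \<open>The delayed strategy\<close>

fun sim_history :: "'v strat \<Rightarrow> 'v set \<Rightarrow> (nat \<Rightarrow> 'v set) \<Rightarrow> nat \<Rightarrow> 'v set list" where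
  "sim_history f q e 0 = [e 0 \<union> q]"
| "sim_history f q e (Suc t) =
    sim_history f q e t @ [e (Suc t) \<union> f (sim_history f q e t) (e (Suc t))]"

definition sim_play :: "'v strat \<Rightarrow> 'v set \<Rightarrow> (nat \<Rightarrow> 'v set) \<Rightarrow> nat \<Rightarrow> 'v set" where
  "sim_play f q e t = last (sim_history f q e t)"

lemma sim_history_eq_map: "sim_history f q e t = map (sim_play f q e) [0..<Suc t]"
proof (induction t)
  case (Suc t)
  have "sim_history f q e (Suc t) = sim_history f q e t @ [sim_play f q e (Suc t)]"
    by (simp add: sim_play_def)
  then show ?case using Suc by simp
qed (simp add: sim_play_def)

text \<open>Causality: the delayed strategy knows only a finite prefix of the environment moves, and
  this prefix determines the simulation so far.\<close>

lemma sim_history_cong: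
  "(\<And>u. u \<le> t \<Longrightarrow> e u = e' u) \<Longrightarrow> sim_history f q e t = sim_history f q e' t"
  by (induction t) auto

lemma finite_path_map_upt:
  assumes "\<And>u. u \<le> t \<Longrightarrow> x u \<in> V" and "\<And>u. u < t \<Longrightarrow> (x u, x (Suc u)) \<in> E"
  shows "finite_path V E (map x [0..<Suc t])"
  using assms unfolding finite_path_def
  by (auto simp: successively_conv_nth simp del: upt_Suc)

text \<open>The clauses of \<open>strategy\<close> serve in turn: by typing, a first induction keeps
  the play inside \<open>states GS\<close>; by legality, a second one makes each step an edge, the
  earlier edges giving the \<open>finite_path\<close> that legality demands.\<close>

lemma sim_play_is_play:
  assumes sep: "separated_game_structure GS" and f: "strategy GS f"
    and q: "q \<subseteq> sys_vars GS"
    and e: "\<And>t. (e t, e (Suc t)) \<in> env_graph GS"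
  shows "play_from GS (e 0 \<union> q) (sim_play f q e)"
    and "consistent GS f (sim_play f q e)"
    and "sim_play f q e t \<inter> env_vars GS = e t"
    and "sim_play f q e 0 \<inter> sys_vars GS = q"
proof -
  let ?\<sigma> = "sim_play f q e"
  have disj: "env_vars GS \<inter> sys_vars GS = {}"
    using sep unfolding separated_game_structure_def by simp
  have e_sub: "e t \<subseteq> env_vars GS" for t
    using e[of t] by (auto simp: env_graph_def)
  have Suc_eq: "?\<sigma> (Suc t) = e (Suc t) \<union> f (map ?\<sigma> [0..<Suc t]) (e (Suc t))" for t
    unfolding sim_history_eq_map[symmetric] by (simp add: sim_play_def)
  have zero: "?\<sigma> 0 = e 0 \<union> q"
    by (simp add: sim_play_def)
  have f_sub: "f (map ?\<sigma> [0..<Suc t]) (e (Suc t)) \<subseteq> sys_vars GS" if "\<forall>u\<le>t. ?\<sigma> u \<in> states GS" for t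
    using that f e_sub unfolding strategy_def by (auto simp del: upt_Suc simp: less_Suc_eq_le image_subset_iff)
  have in_states: "?\<sigma> t \<in> states GS" for t
  proof (induction t rule: less_induct)
    case (less t)
    show ?case
    proof (cases t)
      case 0
      then show ?thesis using zero e_sub[of 0] q by (auto simp: states_def)
    next
      case (Suc u)
      then have "f (map ?\<sigma> [0..<Suc u]) (e (Suc u)) \<subseteq> sys_vars GS"
        using less by (intro f_sub) auto
      then show ?thesis
        using Suc Suc_eq[of u] e_sub[of "Suc u"] by (auto simp: states_def simp del: upt_Suc)
    qed
  qed
  have f_sub: "f (map ?\<sigma> [0..<Suc t]) (e (Suc t)) \<subseteq> sys_vars GS" for t
    using f_sub in_states by blast
  have env: "?\<sigma> t \<inter> env_vars GS = e t" for t
    using disj e_sub[of t] zero q Suc_eq[of "t - 1"] f_sub[of "t - 1"] by (cases t) auto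
  have sys: "?\<sigma> (Suc t) \<inter> sys_vars GS = f (map ?\<sigma> [0..<Suc t]) (e (Suc t))" for t
    using disj e_sub[of "Suc t"] Suc_eq[of t] f_sub[of t] by auto
  have edge: "(?\<sigma> t, ?\<sigma> (Suc t)) \<in> game_graph GS" for t
  proof (induction t rule: less_induct)
    case (less t)
    \<comment> \<open>\<open>X\<close> is general because legality asks for the bare input
      \<open>e (Suc t)\<close>, while the edge asks for the full successor.\<close>
    have env_step: "sat_step (?\<sigma> t) X (env_trans GS)" if "X \<inter> env_vars GS = e (Suc t)" for X
      using e[of t] env[of t] that sep
        sat_step_restrict[of "env_vars GS" "env_trans GS" "?\<sigma> t" X]
      unfolding separated_game_structure_def env_graph_def by simp
    have "finite_path (states GS) (game_graph GS) (map ?\<sigma> [0..<Suc t])"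
      using less in_states by (intro finite_path_map_upt) auto
    moreover have "sat_step (last (map ?\<sigma> [0..<Suc t])) (e (Suc t)) (env_trans GS)"
      using env_step[of "e (Suc t)"] e_sub[of "Suc t"] by (simp add: Int_absorb2)
    ultimately have "sat_step (last (map ?\<sigma> [0..<Suc t])) (?\<sigma> (Suc t)) (sys_trans GS)"
      using f e_sub[of "Suc t"] unfolding strategy_def Suc_eq by blast
    then have "sat_step (?\<sigma> t) (?\<sigma> (Suc t)) (sys_trans GS)"
      by simp
    then show ?case
      using env_step[of "?\<sigma> (Suc t)"] env[of "Suc t"] in_states unfolding game_graph_def by simp
  qed
  show "play_from GS (e 0 \<union> q) ?\<sigma>"
    unfolding play_from_def using zero edge by simp
  show "consistent GS f ?\<sigma>"
    unfolding consistent_def using sys env by simp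
  show "?\<sigma> t \<inter> env_vars GS = e t" by (rule env)
  show "?\<sigma> 0 \<inter> sys_vars GS = q"
    using zero disj e_sub[of 0] q by auto
qed

text \<open>Replacing illegal moves by arbitrary legal ones makes a strategy of any move function; this
  matters only on histories that no consistent play has.\<close>

definition legalize :: "'v game_structure \<Rightarrow> 'v strat \<Rightarrow> 'v strat" where
  "legalize GS g h i = (let s = last h \<inter> sys_vars GS in
     if (s, g h i) \<in> sys_graph GS then g h i else SOME t. (s, t) \<in> sys_graph GS)"

text \<open>Deadlock freedom supplies a witness for \<open>SOME\<close>, so the move is legal
  whatever \<open>g\<close> proposes.\<close>

lemma legalize_move:
  assumes "separated_game_structure GS"
  shows "(last h \<inter> sys_vars GS, legalize GS g h i) \<in> sys_graph GS"
proof -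
  have "\<exists>t. (last h \<inter> sys_vars GS, t) \<in> sys_graph GS"
    using assms unfolding separated_game_structure_def deadlock_free_def sys_graph_def by auto
  then show ?thesis
    unfolding legalize_def Let_def by (auto intro: someI_ex)
qed

lemma legalize_strategy:
  assumes "separated_game_structure GS"
  shows "strategy GS (legalize GS g)"
proof -
  have sub: "legalize GS g h i \<subseteq> sys_vars GS" for h i
    using legalize_move[OF assms, of h g i] by (simp add: sys_graph_def)
  have "sat_step (last h) (i \<union> legalize GS g h i) (sys_trans GS)" if "i \<subseteq> env_vars GS" for h i
  proof -
    have "(i \<union> legalize GS g h i) \<inter> sys_vars GS = legalize GS g h i"
      using that sub[of h i] assms unfolding separated_game_structure_def by auto
    then show ?thesis
      using legalize_move[OF assms, of h g i] assms
        sat_step_restrict[of "sys_vars GS" "sys_trans GS" "last h" "i \<union> legalize GS g h i"]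
      unfolding separated_game_structure_def sys_graph_def by simp
  qed
  then show ?thesis
    unfolding strategy_def using sub by blast
qed

text \<open>The state to be chosen has index \<open>length h\<close>, and the simulation lags behind
  by the \<open>length opath - 1\<close> steps of \<open>opath\<close>. \<open>butlast\<close> is
  there because \<open>last ipath\<close> reappears as the input part of \<open>hd h\<close>. The
  index stays in range up to the simulated time.\<close>

definition delayed_move ::
  "'v game_structure \<Rightarrow> 'v strat \<Rightarrow> 'v set list \<Rightarrow> 'v set list \<Rightarrow> 'v strat" where
  "delayed_move GS f ipath opath h i =
     (if length h < length opath then opath ! length h
      else sim_play f (last opath)
        (\<lambda>t. (butlast ipath @ map (\<lambda>s. s \<inter> env_vars GS) h @ [i]) ! t)
        (length h - (length opath - 1)) \<inter> sys_vars GS)"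

theorem theorem1:
  fixes GS :: "'v game_structure" and \<phi> :: "'v gr_spec" and k :: nat
    and ipath opath :: "'v set list"
  assumes "separated_GR_game k GS \<phi>"
    and "finite_path (Pow (env_vars GS)) (env_graph GS) ipath"
    and "finite_path (Pow (sys_vars GS)) (sys_graph GS) opath"
    and "sys_can_win GS (GF (acc GS \<phi>)) (hd ipath \<union> last opath)"
  shows "sys_can_win GS (GF (acc GS \<phi>)) (last ipath \<union> hd opath)"
proof -
  have sep: "separated_game_structure GS"
    using assms(1) unfolding separated_GR_game_def by simp
  have disj: "env_vars GS \<inter> sys_vars GS = {}"
    using sep unfolding separated_game_structure_def by simp
  obtain f where f: "strategy GS f"
    and win: "\<And>\<sigma>. play_from GS (hd ipath \<union> last opath) \<sigma> \<Longrightarrow> consistent GS f \<sigma> \<Longrightarrow> GF (acc GS \<phi>) \<sigma>"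
    using assms(4) unfolding sys_can_win_def by blast
  have ne: "ipath \<noteq> []" "opath \<noteq> []"
    and ip: "\<And>u. Suc u < length ipath \<Longrightarrow> (ipath ! u, ipath ! Suc u) \<in> env_graph GS"
    and op: "\<And>u. Suc u < length opath \<Longrightarrow> (opath ! u, opath ! Suc u) \<in> sys_graph GS"
    and sub: "set ipath \<subseteq> Pow (env_vars GS)" "set opath \<subseteq> Pow (sys_vars GS)"
    using assms(2,3) unfolding finite_path_def by (auto simp: successively_conv_nth)
  \<comment> \<open>Step counts: \<open>ipath ! u\<close> is \<open>i_u\<close>, and
    \<open>opath ! u\<close> is \<open>o_(u-m)\<close>.\<close>
  define n where "n = length ipath - 1"
  define m where "m = length opath - 1"
  have len: "length ipath = Suc n" "length opath = Suc m"
    using ne unfolding n_def m_def by simp_all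
  have ends: "hd ipath = ipath ! 0" "last ipath = ipath ! n" "hd opath = opath ! 0" "last opath = opath ! m"
    using ne by (simp_all add: hd_conv_nth last_conv_nth n_def m_def)
  have subs: "last ipath \<subseteq> env_vars GS" "hd opath \<subseteq> sys_vars GS" "last opath \<subseteq> sys_vars GS"
    using sub ne last_in_set hd_in_set by blast+
  define f' where "f' = legalize GS (delayed_move GS f ipath opath)"
  have "GF (acc GS \<phi>) \<tau>"
    if play: "play_from GS (last ipath \<union> hd opath) \<tau>" and cons: "consistent GS f' \<tau>" for \<tau>
  proof -
    have \<tau>: "(\<tau> t, \<tau> (Suc t)) \<in> game_graph GS" for t
      using play unfolding play_from_def by simp
    have \<tau>0: "\<tau> 0 \<inter> env_vars GS = last ipath" "\<tau> 0 \<inter> sys_vars GS = hd opath"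
      using play subs disj unfolding play_from_def by auto
    \<comment> \<open>The environment side of the simulated play. At the seam \<open>t = n\<close>
      the two pieces fit, as \<open>\<tau> 0\<close> has input part
      \<open>last ipath\<close>.\<close>
    define e where "e t = (if t < n then ipath ! t else \<tau> (t - n) \<inter> env_vars GS)" for t
    have e_edge: "(e t, e (Suc t)) \<in> env_graph GS" for t
    proof -
      consider "Suc t < n" | "Suc t = n" | "n \<le> t" by linarith
      then show ?thesis
      proof cases
        case 3
        then show ?thesis
          using \<tau>[of "t - n"] by (simp add: e_def game_graph_iff[OF sep] Suc_diff_le)
      qed (use ip[of t] len \<tau>0 ends in \<open>auto simp: e_def\<close>)
    qed
    have e0: "e 0 = hd ipath"
      using \<tau>0 ends by (auto simp: e_def)
    define \<sigma> where "\<sigma> = sim_play f (last opath) e"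
    note sim = sim_play_is_play[where e = e, OF sep f subs(3) e_edge, folded \<sigma>_def, unfolded e0]
    have \<sigma>: "(\<sigma> t, \<sigma> (Suc t)) \<in> game_graph GS" for t
      using sim(1) unfolding play_from_def by simp
    \<comment> \<open>The system side that the real play should have; the seam at
      \<open>t = m\<close> is \<open>last opath\<close>.\<close>
    define w where "w t = (if t < m then opath ! t else \<sigma> (t - m) \<inter> sys_vars GS)" for t
    have w_edge: "(w t, w (Suc t)) \<in> sys_graph GS" for t
    proof -
      consider "Suc t < m" | "Suc t = m" | "m \<le> t" by linarith
      then show ?thesis
      proof cases
        case 3
        then show ?thesis
          using \<sigma>[of "t - m"] by (simp add: w_def game_graph_iff[OF sep] Suc_diff_le)
      qed (use op[of t] len sim(4) ends in \<open>auto simp: w_def\<close>)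
    qed
    have move: "delayed_move GS f ipath opath (map \<tau> [0..<Suc t]) (\<tau> (Suc t) \<inter> env_vars GS) = w (Suc t)" for t
    proof (cases "Suc t < length opath")
      case True
      \<comment> \<open>The two definitions switch at different times: at \<open>Suc t = m\<close>,
        \<open>delayed_move\<close> still reads \<open>opath\<close> while \<open>w\<close> already
        reads \<open>\<sigma> 0\<close>. Both give \<open>last opath\<close>.\<close>
      then show ?thesis
        using len sim(4) ends by (cases "Suc t = m") (auto simp: delayed_move_def w_def simp del: upt_Suc)
    next
      case False
      let ?e = "\<lambda>u. (butlast ipath @ map (\<lambda>s. s \<inter> env_vars GS) (map \<tau> [0..<Suc t]) @ [\<tau> (Suc t) \<inter> env_vars GS]) ! u"
      have "?e u = e u" if "u \<le> Suc t - m" for u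
      proof -
        have "map (\<lambda>s. s \<inter> env_vars GS) (map \<tau> [0..<Suc t]) @ [\<tau> (Suc t) \<inter> env_vars GS] =
            map (\<lambda>u. \<tau> u \<inter> env_vars GS) [0..<Suc (Suc t)]" by simp
        then show ?thesis
          using that len by (auto simp: e_def nth_append nth_butlast simp del: upt_Suc)
      qed
      then have "sim_play f (last opath) ?e (Suc t - m) = \<sigma> (Suc t - m)"
        unfolding \<sigma>_def sim_play_def by (intro arg_cong[where f = last] sim_history_cong) blast
      then show ?thesis
        using False len by (simp add: delayed_move_def w_def del: upt_Suc)
    qed
    have sys: "\<tau> t \<inter> sys_vars GS = w t" for t
    proof (induction t)
      case 0
      then show ?case using \<tau>0 ends sim(4) by (auto simp: w_def)
    next
      case (Suc t)
      have "\<tau> (Suc t) \<inter> sys_vars GS = f' (map \<tau> [0..<Suc t]) (\<tau> (Suc t) \<inter> env_vars GS)"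
        using cons unfolding consistent_def by blast
      \<comment> \<open>The induction hypothesis places the history at \<open>w t\<close>, and
        \<open>w\<close> is a path in \<open>sys_graph GS\<close>, so \<open>legalize\<close> keeps
        the proposed move.\<close>
      also have "\<dots> = w (Suc t)"
        unfolding f'_def legalize_def Let_def move using Suc w_edge[of t] by simp
      finally show ?case .
    qed
    show ?thesis
    proof (rule GF_acc_shift[where \<sigma> = \<sigma> and \<tau> = \<tau>, OF sep \<sigma> \<tau>])
      show "\<tau> (t + m) \<inter> env_vars GS = \<sigma> (t + (m + n)) \<inter> env_vars GS" for t
        unfolding sim(3) by (simp add: e_def)
      show "\<tau> (t + m) \<inter> sys_vars GS = \<sigma> t \<inter> sys_vars GS" for t
        unfolding sys by (simp add: w_def)
      show "GF (acc GS \<phi>) \<sigma>"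
        using sim(1,2) by (rule win)
    qed
  qed
  moreover have "strategy GS f'"
    unfolding f'_def using sep by (rule legalize_strategy)
  ultimately show ?thesis
    unfolding sys_can_win_def by blast
qed

end
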